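(* Let $n \ge 1$, let $B_0(n)$ be the set of binary words of length $n$ whose first bit is $0$, and let $\alpha_0,\alpha_1,\ldots,\alpha_{N-1}$ with $N = 2^{n-1}$ be the words of $B_0(n)$ in lexicographic order. For any integer $k \ge 0$, the sequence $\alpha_0^k\alpha_1^k\cdots\alpha_{N-1}^k$ (the concatenation of $k$ copies of each word, in lexicographic order) is a multiversal cycle of the unlabeled binary words $U(n)$ with multiplicity $r = kn$.
   Context: Let $B(n)$ be the set of binary words of length $n$, and for $w\in B(n)$ let $\overline{w}$ be its bitwise complement. Unlabeled binary words of length $n$ are binary words with $w$ and $\overline{w}$ regarded as equivalent; $U(n)$ denotes any set containing exactly one representative of each of the $2^{n-1}$ pairs $\{w,\overline{w}\}$. A multiversal cycle of $U(n)$ of multiplicity (repetition) $r$ is a binary sequence $S = s_0 s_1\cdots s_{|S|-1}$ (indices modulo $|S|$) with $|S| = r\cdot 2^{n-1}$ such that for every $0 \le j < r$ the set of words $$\{\, s_{j+tr}\, s_{j+tr+1}\cdots s_{j+tr+n-1} : 0 \le t < 2^{n-1} \,\}$$ contains exactly one word from each pair $\{w,\overline{w}\}$, $w\in B(n)$. (The set represented may be a different choice of representatives for different $j$.) *)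

theory Defs
  imports Main "HOL-Library.List_Lexorder"
begin

text \<open>Bits are booleans, with \<open>False\<close> for 0 and \<open>True\<close> for 1, so that \<open>0 < 1\<close>.\<close>

definition binary_words :: "nat \<Rightarrow> bool list set" where
  "binary_words n = {w. length w = n}"

definition complement :: "bool list \<Rightarrow> bool list" where
  "complement w = map Not w"

text \<open>\<open>unlabeled_words n U\<close>: the set \<open>U\<close> is one of the possible choices of \<open>U(n)\<close>.\<close>

definition unlabeled_words :: "nat \<Rightarrow> bool list set \<Rightarrow> bool" where
  "unlabeled_words n U \<longleftrightarrow>
     U \<subseteq> binary_words n \<and>
     (\<forall>w \<in> binary_words n. \<exists>!v. v \<in> {w, complement w} \<and> v \<in> U)"

definition cyclic_factor :: "'a list \<Rightarrow> nat \<Rightarrow> nat \<Rightarrow> 'a list" where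
  "cyclic_factor s i n = map (\<lambda>m. s ! ((i + m) mod length s)) [0..<n]"

text \<open>
  Meaningful for \<open>n \<ge> 1\<close> only, because the subtraction in the exponent is truncated.
  For \<open>r = 0\<close> the only such cycle is the empty sequence.
\<close>

definition multiversal_cycle :: "nat \<Rightarrow> nat \<Rightarrow> bool list \<Rightarrow> bool" where
  "multiversal_cycle n r s \<longleftrightarrow>
     length s = r * 2 ^ (n - 1) \<and>
     (\<forall>j < r. unlabeled_words n {cyclic_factor s (j + t * r) n | t. t < 2 ^ (n - 1)})"

definition words_starting_with_0 :: "nat \<Rightarrow> bool list set" where
  "words_starting_with_0 n = {w \<in> binary_words n. hd w = False}"

text \<open>The order on lists used for sorting is the lexicographic one from \<open>List_Lexorder\<close>.\<close>

definition lex_words_starting_with_0 :: "nat \<Rightarrow> bool list list" where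
  "lex_words_starting_with_0 n = sorted_list_of_set (words_starting_with_0 n)"

definition word_power :: "'a list \<Rightarrow> nat \<Rightarrow> 'a list" where
  "word_power w k = concat (replicate k w)"

end

theory Submission
  imports Defs
begin

text \<open>
  Write \<open>r = k * n\<close> and \<open>N = 2 ^ (n - 1)\<close>, and fix \<open>j < r\<close>.  Position \<open>i\<close> of the sequence carries
  bit \<open>i mod n\<close> of the word \<open>\<alpha>\<^sub>q\<close> with \<open>q = i div r\<close>, so all positions divisible by \<open>n\<close> carry 0.
  Hence the factors at the positions \<open>j + t * r\<close> all vanish in the column \<open>c\<close> with \<open>n dvd j + c\<close>,
  and it suffices that every word vanishing in column \<open>c\<close> occurs.  A factor inside one block is
  a rotation of \<open>\<alpha>\<^sub>t\<close>.  A factor across a block boundary is the suffix of length \<open>c\<close> of \<open>\<alpha>\<^sub>t\<close>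
  followed by a prefix of its cyclic successor; these can be prescribed independently, since
  \<open>t mod 2 ^ c\<close> and \<open>((t + 1) mod N) div 2 ^ c\<close> can be.
\<close>

section \<open>Words as binary expansions of numbers\<close>

text \<open>The most significant bit comes first, so that numerical order below \<open>2 ^ n\<close>
  becomes lexicographic order. Bits of \<open>t\<close> from position \<open>n\<close> upward are
  dropped.\<close>

definition bin_word :: "nat \<Rightarrow> nat \<Rightarrow> bool list" where
  "bin_word n t = map (\<lambda>m. bit t (n - 1 - m)) [0..<n]"

lemma length_bin_word [simp]: "length (bin_word n t) = n"
  by (simp add: bin_word_def)

lemma nth_bin_word: "m < n \<Longrightarrow> bin_word n t ! m = bit t (n - 1 - m)"
  by (simp add: bin_word_def)

lemma bin_word_Suc: "bin_word (Suc n) t = bit t n # bin_word n t"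
  by (rule nth_equalityI) (auto simp: nth_bin_word nth_Cons split: nat.split)

lemma bit_eq_if_mod_eq:
  fixes x y :: nat
  assumes "x mod 2 ^ d = y mod 2 ^ d" "i < d"
  shows "bit x i = bit y i"
  using assms by (metis bit_take_bit_iff take_bit_eq_mod)

lemma bit_eq_if_div_eq:
  fixes x y :: nat
  assumes "x div 2 ^ d = y div 2 ^ d" "d \<le> i"
  shows "bit x i = bit y i"
  using assms by (metis bit_drop_bit_eq comp_apply drop_bit_eq_div le_add_diff_inverse)

lemma not_bit_if_less_power: "x < 2 ^ n \<Longrightarrow> \<not> bit (x :: nat) n"
  by (simp add: bit_iff_odd)

lemma bin_word_mod: "bin_word n (t mod 2 ^ n) = bin_word n t"
  by (rule nth_equalityI) (auto simp: nth_bin_word intro!: bit_eq_if_mod_eq[where d = n])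

text \<open>Induction on the leading bit: if \<open>t\<close> and \<open>u\<close> differ there, the
  first letter decides; otherwise their residues modulo \<open>2 ^ n\<close> are still in the same
  strict order.\<close>

lemma bin_word_strict_mono:
  "t < u \<Longrightarrow> u < 2 ^ n \<Longrightarrow> bin_word n t < bin_word n u"
proof (induction n arbitrary: t u)
  case (Suc n)
  have top: "bit x n \<longleftrightarrow> 2 ^ n \<le> x" and md: "x mod 2 ^ n = (if 2 ^ n \<le> x then x - 2 ^ n else x)"
    if "x < 2 ^ Suc n" for x :: nat
  proof -
    have "x div 2 ^ n = (if 2 ^ n \<le> x then 1 else 0)"
      using that by (auto intro: div_nat_eqI)
    then show "bit x n \<longleftrightarrow> 2 ^ n \<le> x" by (simp add: bit_iff_odd)
    show "x mod 2 ^ n = (if 2 ^ n \<le> x then x - 2 ^ n else x)"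
      using that by (auto simp: le_mod_geq)
  qed
  have t: "t < 2 ^ Suc n" using Suc.prems by simp
  show ?case
  proof (cases "bit t n = bit u n")
    case True
    have "t mod 2 ^ n < u mod 2 ^ n"
      using True Suc.prems top[OF t] top[OF Suc.prems(2)] md[OF t] md[OF Suc.prems(2)]
      by (auto split: if_splits)
    then have "bin_word n (t mod 2 ^ n) < bin_word n (u mod 2 ^ n)"
      by (rule Suc.IH) simp
    then show ?thesis using True by (simp add: bin_word_Suc bin_word_mod)
  next
    case False
    then show ?thesis
      using Suc.prems top[OF t] top[OF Suc.prems(2)] by (auto simp: bin_word_Suc)
  qed
qed simp

lemma bin_word_surj: "\<exists>t < 2 ^ length w. bin_word (length w) t = w"
proof (intro exI conjI)
  \<comment> \<open>\<open>horner_sum\<close> reads its list from the least significant bit, hence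
    the reversal.\<close>
  let ?t = "horner_sum of_bool 2 (rev w) :: nat"
  show "?t < 2 ^ length w"
    using horner_sum_bound[of "rev w", where 'a = nat] by simp
  show "bin_word (length w) ?t = w"
    by (rule nth_equalityI) (auto simp: nth_bin_word bit_horner_sum_bit_iff rev_nth)
qed

lemma bin_word_surj_half:
  assumes "w \<noteq> []" "\<not> hd w"
  shows "\<exists>t < 2 ^ (length w - 1). bin_word (length w) t = w"
proof -
  obtain v where w: "w = False # v" using assms by (cases w) auto
  obtain t where "t < 2 ^ length v" "bin_word (length v) t = v"
    using bin_word_surj by blast
  then show ?thesis
    by (auto simp: w bin_word_Suc not_bit_if_less_power)
qed

text \<open>A leading 0 means that the number is below \<open>2 ^ (n - 1)\<close>. By strict
  monotonicity the list of expansions is already sorted and distinct, so sorting its set returns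
  it.\<close>

lemma lex_words_eq:
  assumes "n \<ge> 1"
  shows "lex_words_starting_with_0 n = map (bin_word n) [0..<2 ^ (n - 1)]"
proof -
  have set: "words_starting_with_0 n = set (map (bin_word n) [0..<2 ^ (n - 1)])"
  proof (intro equalityI subsetI)
    fix w assume "w \<in> words_starting_with_0 n"
    then have "length w = n" "w \<noteq> []" "\<not> hd w"
      using assms by (auto simp: words_starting_with_0_def binary_words_def)
    with bin_word_surj_half[of w] show "w \<in> set (map (bin_word n) [0..<2 ^ (n - 1)])" by force
  next
    fix w assume "w \<in> set (map (bin_word n) [0..<2 ^ (n - 1)])"
    moreover obtain n' where "n = Suc n'" using assms by (cases n) auto
    ultimately show "w \<in> words_starting_with_0 n"
      by (auto simp: words_starting_with_0_def binary_words_def bin_word_Suc not_bit_if_less_power)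
  qed
  have "u < 2 ^ n" if "u < 2 ^ (n - 1)" for u :: nat
    using that by (rule less_le_trans) (simp add: power_increasing)
  then have "sorted_wrt (<) (map (bin_word n) [0..<2 ^ (n - 1)])"
    by (auto simp del: One_nat_def simp: sorted_wrt_iff_nth_less intro!: bin_word_strict_mono)
  then show ?thesis
    unfolding lex_words_starting_with_0_def set
    by (intro sorted_list_of_set.idem_if_sorted_distinct) (simp_all add: strict_sorted_iff)
qed

section \<open>Indexing in concatenations of blocks of equal length\<close>

lemma length_concat_blocks:
  assumes "\<And>t. length (f t) = r"
  shows "length (concat (map f [0..<N])) = r * N"
  by (induction N) (auto simp: assms)

lemma nth_concat_blocks:
  assumes len: "\<And>t. length (f t) = r"
  shows "i < r * N \<Longrightarrow> concat (map f [0..<N]) ! i = f (i div r) ! (i mod r)"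
proof (induction N)
  case (Suc N)
  show ?case
  proof (cases "i < r * N")
    case True
    then show ?thesis
      using Suc.IH by (simp add: nth_append length_concat_blocks[of f, OF len])
  next
    case False
    have "i div r = N"
      using False Suc.prems by (intro div_nat_eqI) (auto simp: mult.commute)
    moreover from this have "i mod r = i - r * N"
      by (metis minus_mult_div_eq_mod)
    ultimately show ?thesis
      using False by (simp add: nth_append length_concat_blocks[of f, OF len])
  qed
qed simp

lemma word_power_eq_blocks: "word_power w k = concat (map (\<lambda>_. w) [0..<k])"
  by (simp add: word_power_def map_replicate_const)

lemma length_word_power: "length (word_power w k) = k * length w"
  by (simp add: word_power_eq_blocks length_concat_blocks[of "\<lambda>_. w"])

lemma nth_word_power: "i < k * length w \<Longrightarrow> word_power w k ! i = w ! (i mod length w)"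
  using nth_concat_blocks[of "\<lambda>_. w" "length w" i k]
  by (simp add: word_power_eq_blocks mult.commute)

text \<open>Complementing flips column \<open>c\<close>, so exactly one word of each pair has a 0
  there.\<close>

lemma unlabeled_words_zero_column:
  assumes "c < n"
  shows "unlabeled_words n {w \<in> binary_words n. \<not> w ! c}"
proof -
  have "\<exists>!v. v \<in> {w, complement w} \<and> v \<in> {w \<in> binary_words n. \<not> w ! c}"
    if "w \<in> binary_words n" for w
  proof -
    have "complement w \<in> binary_words n" "complement w ! c = (\<not> w ! c)"
      using that assms by (auto simp: binary_words_def complement_def)
    then show ?thesis using that by (cases "w ! c") auto
  qed
  then show ?thesis by (auto simp: unlabeled_words_def)
qed

lemma ex_less_power_split:
  fixes x :: nat
  assumes "x < 2 ^ e" "d \<le> e"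
  shows "\<exists>t < 2 ^ e. t mod 2 ^ d = x mod 2 ^ d \<and> (t + 1) mod 2 ^ e div 2 ^ d = x div 2 ^ d"
proof -
  define D N :: nat where "D = 2 ^ d" and "N = 2 ^ e"
  have D: "D > 0" and "N > 0" by (simp_all add: D_def N_def)
  obtain M where N: "N = D * M"
    using le_imp_power_dvd[OF assms(2), of "2 :: nat"] by (auto simp: D_def N_def elim: dvdE)
  \<comment> \<open>The future successor of \<open>t\<close>: it keeps the quotient of
    \<open>x\<close> but takes the remainder of \<open>x + 1\<close>, reduced so that no carry
    reaches the quotient.\<close>
  define u where "u = D * (x div D) + (x + 1) mod D"
  \<comment> \<open>The cyclic predecessor of \<open>u\<close>; adding \<open>N - 1\<close> avoids
    truncated subtraction. As \<open>D\<close> divides \<open>N\<close>, this also steps back by one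
    modulo \<open>D\<close>, to the remainder of \<open>x\<close>.\<close>
  define t where "t = (u + (N - 1)) mod N"
  have udiv: "u div D = x div D" using D by (simp add: u_def)
  have "x div D < M"
    using assms(1) N D by (simp add: N_def[symmetric] div_less_iff_less_mult mult.commute)
  then have "u < N"
    using udiv N D by (metis div_less_iff_less_mult mult.commute)
  have "(t + 1) mod N = (u + (N - 1) + 1) mod N"
    unfolding t_def by (rule mod_add_left_eq)
  also have "\<dots> = u" using \<open>u < N\<close> by simp
  finally have "(t + 1) mod N div D = x div D" using udiv by simp
  moreover have "t mod D = x mod D"
  proof -
    have "t mod D = (u + (N - 1)) mod D"
      unfolding t_def N by (simp add: mod_mult2_eq)
    also have "\<dots> = (u mod D + (N - 1)) mod D" by (simp add: mod_add_left_eq)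
    also have "u mod D = (x + 1) mod D" by (simp add: u_def)
    also have "((x + 1) mod D + (N - 1)) mod D = (x + 1 + (N - 1)) mod D"
      by (rule mod_add_left_eq)
    also have "x + 1 + (N - 1) = x + D * M" using \<open>N > 0\<close> N by simp
    finally show ?thesis by simp
  qed
  moreover have "t < N" using \<open>N > 0\<close> by (simp add: t_def)
  ultimately show ?thesis unfolding D_def N_def by blast
qed

section \<open>The sequence and its cyclic factors\<close>

context
  fixes n k :: nat and s :: "bool list"
  assumes n: "n \<ge> 1"
  defines "s \<equiv> concat (map (\<lambda>w. word_power w k) (lex_words_starting_with_0 n))"
begin

lemma s_eq_blocks: "s = concat (map (\<lambda>t. word_power (bin_word n t) k) [0..<2 ^ (n - 1)])"
  by (simp add: s_def lex_words_eq[OF n] comp_def)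

lemma length_s: "length s = k * n * 2 ^ (n - 1)"
  unfolding s_eq_blocks by (rule length_concat_blocks) (simp add: length_word_power)

lemma nth_s:
  assumes "i < k * n * 2 ^ (n - 1)"
  shows "s ! i = bit (i div (k * n)) (n - 1 - i mod n)"
proof -
  have "s ! i = word_power (bin_word n (i div (k * n))) k ! (i mod (k * n))"
    unfolding s_eq_blocks
    using assms by (intro nth_concat_blocks) (simp_all add: length_word_power)
  also have "\<dots> = bin_word n (i div (k * n)) ! (i mod (k * n) mod n)"
    using assms by (subst nth_word_power) (auto intro!: mod_less_divisor intro: gr0I)
  also have "i mod (k * n) mod n = i mod n" by (simp add: mod_mod_cancel)
  finally show ?thesis using n by (simp add: nth_bin_word)
qed

text \<open>The length is a multiple of \<open>k * n\<close>, so wrapping around only reduces the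
  block index modulo \<open>2 ^ (n - 1)\<close> and preserves the column modulo \<open>n\<close>.
  The quotient \<open>(j + m) div (k * n)\<close> is 0 before the block boundary and 1 after
  it.\<close>

lemma nth_cyclic_factor_s:
  assumes "m < n" "j < k * n"
  shows "cyclic_factor s (j + t * (k * n)) n ! m
    = bit ((t + (j + m) div (k * n)) mod 2 ^ (n - 1)) (n - 1 - (j + m) mod n)"
proof -
  define r where "r = k * n"
  define i where "i = (j + t * r + m) mod (r * 2 ^ (n - 1))"
  have r: "r > 0" using assms by (auto simp: r_def intro: gr0I)
  have i: "i < r * 2 ^ (n - 1)" using r by (simp add: i_def)
  have "(j + t * r + m) div r = t + (j + m) div r"
    using r div_mult_self1[of r "j + m" t] by (simp add: algebra_simps)
  then have "i div r = (t + (j + m) div r) mod 2 ^ (n - 1)"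
    using r by (simp add: i_def mod_mult2_eq)
  moreover have "i mod n = (j + m) mod n"
  proof -
    have "i mod n = (j + t * r + m) mod n"
      unfolding i_def by (rule mod_mod_cancel) (simp add: r_def)
    also have "j + t * r + m = j + m + t * k * n" by (simp add: r_def)
    finally show ?thesis by simp
  qed
  moreover have "cyclic_factor s (j + t * r) n ! m = s ! i"
    using assms by (simp add: cyclic_factor_def length_s i_def r_def)
  ultimately show ?thesis using nth_s i by (simp add: r_def)
qed

lemma cyclic_factors_s:
  assumes j: "j < k * n" and c: "c < n" "n dvd j + c"
  shows "{cyclic_factor s (j + t * (k * n)) n | t. t < 2 ^ (n - 1)}
    = {w \<in> binary_words n. \<not> w ! c}" (is "?L = ?R")
proof (intro equalityI subsetI)
  fix w assume "w \<in> ?L"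
  \<comment> \<open>At offset \<open>c\<close> the column is 0, so the letter is bit
    \<open>n - 1\<close> of a block index below \<open>2 ^ (n - 1)\<close>.\<close>
  then show "w \<in> ?R"
    using c by (auto simp: binary_words_def nth_cyclic_factor_s[OF c(1) j] not_bit_if_less_power
        dvd_imp_mod_0) (simp add: cyclic_factor_def)
next
  fix w assume "w \<in> ?R"
  then have w: "length w = n" "\<not> w ! c" by (auto simp: binary_words_def)
  \<comment> \<open>Rotating the 0 of column \<open>c\<close> to the front gives the block word
    whose repetition, read from phase \<open>j\<close>, shows \<open>w\<close>.\<close>
  define v where "v = rotate c w"
  have v: "v ! i = w ! ((c + i) mod n)" if "i < n" for i
    using that w by (simp add: v_def nth_rotate add.commute)
  have "v \<noteq> []" "\<not> hd v" "length v = n"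
    using w n c v[of 0] by (auto simp: v_def hd_conv_nth simp flip: length_greater_0_conv)
  with bin_word_surj_half[of v] obtain x where x: "x < 2 ^ (n - 1)" "bin_word n x = v" by auto
  have bit_x: "bit x (n - 1 - (j + m) mod n) = w ! m" if "m < n" for m
  proof -
    have "bit x (n - 1 - (j + m) mod n) = v ! ((j + m) mod n)"
      using x n by (metis mod_less_divisor nth_bin_word less_le_trans zero_less_one)
    also have "\<dots> = w ! ((c + (j + m) mod n) mod n)" using n by (simp add: v)
    also have "(c + (j + m) mod n) mod n = ((j + c) + m) mod n"
      by (simp add: mod_add_right_eq algebra_simps)
    also have "\<dots> = m" using c(2) that by (auto elim!: dvdE)
    finally show ?thesis .
  qed
  have "\<exists>t < 2 ^ (n - 1). \<forall>m < n.
    bit ((t + (j + m) div (k * n)) mod 2 ^ (n - 1)) (n - 1 - (j + m) mod n) = w ! m"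
  proof (cases "j + n \<le> k * n")
    case True
    then have "(j + m) div (k * n) = 0" if "m < n" for m using that by simp
    then show ?thesis using x bit_x by auto
  next
    case False
    \<comment> \<open>The number of letters read before the boundary. They are the last
      \<open>d\<close> letters of block \<open>t\<close>, that is its bits below \<open>d\<close>;
      the other \<open>n - d\<close> letters begin the next block and are the bits of its index from
      \<open>d\<close> upward. Hence \<open>t\<close> must share the low bits of \<open>x\<close>,
      and its successor the high bits.\<close>
    define d where "d = k * n - j"
    have d: "j + d = k * n" "d < n" "d > 0" using j False by (auto simp: d_def)
    from d have "k \<ge> 1" by (cases k) auto
    then have jn: "j = (k - 1) * n + (n - d)" using d by (cases k) auto
    have "d \<le> n - 1" using d(2) by simp
    obtain t where t: "t < 2 ^ (n - 1)" "t mod 2 ^ d = x mod 2 ^ d"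
      "(t + 1) mod 2 ^ (n - 1) div 2 ^ d = x div 2 ^ d"
      using ex_less_power_split[OF x(1) \<open>d \<le> n - 1\<close>] by blast
    have "bit ((t + (j + m) div (k * n)) mod 2 ^ (n - 1)) (n - 1 - (j + m) mod n) = w ! m"
      if m: "m < n" for m
    proof (cases "m < d")
      case True
      then have 1: "(j + m) div (k * n) = 0" using d by simp
      have "j + m = (n - d + m) + (k - 1) * n" by (simp add: jn)
      then have "(j + m) mod n = (n - d + m) mod n" by (metis mod_mult_self1)
      also have "\<dots> = n - d + m" using True d(2) by simp
      finally have "(j + m) mod n = n - d + m" .
      then have "n - 1 - (j + m) mod n < d" using True d by simp
      from bit_eq_if_mod_eq[OF t(2) this] show ?thesis using 1 t(1) bit_x[OF m] by simp
    next
      case False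
      then have jm: "j + m = k * n + (m - d)" using d by simp
      have "m - d < k * n" using m \<open>k \<ge> 1\<close> d by (cases k) auto
      then have 1: "(j + m) div (k * n) = 1" using jm by (intro div_nat_eqI) auto
      have "(j + m) mod n = m - d" using m by (simp add: jm)
      then have "d \<le> n - 1 - (j + m) mod n" using m False by simp
      from bit_eq_if_div_eq[OF t(3) this] show ?thesis using 1 bit_x[OF m] by simp
    qed
    with t(1) show ?thesis by blast
  qed
  then obtain t where t: "t < 2 ^ (n - 1)"
    "\<forall>m < n. cyclic_factor s (j + t * (k * n)) n ! m = w ! m"
    using nth_cyclic_factor_s[OF _ j] by auto
  then have "cyclic_factor s (j + t * (k * n)) n = w"
    using w by (intro nth_equalityI) (auto simp: cyclic_factor_def)
  with t(1) show "w \<in> ?L" by blast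
qed

lemma multiversal_cycle_s: "multiversal_cycle n (k * n) s"
proof -
  have "unlabeled_words n {cyclic_factor s (j + t * (k * n)) n | t. t < 2 ^ (n - 1)}"
    if "j < k * n" for j
  proof -
    \<comment> \<open>The outer \<open>mod\<close> gives \<open>c = 0\<close> instead of
      \<open>n\<close> when \<open>n\<close> divides \<open>j\<close>.\<close>
    define c where "c = (n - j mod n) mod n"
    have "c < n" using n by (simp add: c_def)
    moreover have "(j + c) mod n = (j mod n + (n - j mod n)) mod n"
      unfolding c_def by (simp add: mod_simps)
    then have "n dvd j + c" using n by (simp add: dvd_eq_mod_eq_0 less_imp_le)
    ultimately show ?thesis
      using cyclic_factors_s[OF that] unlabeled_words_zero_column by simp
  qed
  then show ?thesis by (simp add: multiversal_cycle_def length_s)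
qed

end

theorem theorem12:
  fixes n k :: nat
  assumes "n \<ge> 1"
  shows "multiversal_cycle n (k * n)
           (concat (map (\<lambda>w. word_power w k) (lex_words_starting_with_0 n)))"
  using assms by (rule multiversal_cycle_s)

end
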